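(* Let $(X,d,\succcurlyeq)$ be a radial partially ordered metric space. Then there exists a set $\mathcal{F}\subseteq\mathrm{Lip}_{1,\uparrow}(X)$ that represents $\succcurlyeq$. Moreover, if $(X,d)$ is compact, then $\mathcal{F}$ can be chosen in such a way that it is compact and $\sup_{F\in\mathcal{F}}\|F\|_\infty\le\mathrm{diam}(X)$.
   Context: A partially ordered metric space is a triple $(X,d,\succcurlyeq)$ where $X$ is a nonempty set, $(X,d)$ is a metric space and $\succcurlyeq$ is a partial order on $X$; no compatibility between $d$ and $\succcurlyeq$ is assumed. Write $x\succ y$ if $x\succcurlyeq y$ and $x\neq y$, and write $x\succcurlyeq^{\bullet}y$ if it is not the case that $y\succcurlyeq x$. $(X,d,\succcurlyeq)$ is radial if for all $x,y,z\in X$: (i) $x\succcurlyeq^{\bullet}y\succ z$ implies $d(x,z)\ge d(x,y)$; and (ii) $x\succ y\succcurlyeq^{\bullet}z$ implies $d(x,z)\ge d(y,z)$. $\mathrm{Lip}_{1,\uparrow}(X)$ is the set of all functions $F:X\to\mathbb{R}$ that are $1$-Lipschitz and $\succcurlyeq$-increasing ($F(x)\ge F(y)$ whenever $x\succcurlyeq y$), considered as a metric space with the uniform (sup) metric; compactness of $\mathcal{F}$ is relative to this metric. A set $\mathcal{F}\subseteq\mathbb{R}^X$ represents $\succcurlyeq$ if for all $x,y\in X$: $x\succcurlyeq y$ if and only if $F(x)\ge F(y)$ for every $F\in\mathcal{F}$. *)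

theory Defs
  imports "HOL-Analysis.Analysis"
begin

text \<open>
  The underlying set \<open>X\<close> is an arbitrary type of class \<open>metric_space\<close> (hence nonempty), and
  the order is a binary predicate \<open>ge\<close>, where \<open>ge x y\<close> stands for \<open>x \<succcurlyeq> y\<close>. Neither
  is tied to the type's own order classes.
\<close>

definition is_partial_order :: "('a \<Rightarrow> 'a \<Rightarrow> bool) \<Rightarrow> bool" where
  "is_partial_order ge \<longleftrightarrow> reflp ge \<and> antisymp ge \<and> transp ge"

definition strict :: "('a \<Rightarrow> 'a \<Rightarrow> bool) \<Rightarrow> 'a \<Rightarrow> 'a \<Rightarrow> bool" where
  "strict ge x y \<longleftrightarrow> ge x y \<and> x \<noteq> y"

text \<open>\<open>x \<succcurlyeq>\<^sup>\<bullet> y\<close>: strictly above or incomparable.\<close>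

definition not_below :: "('a \<Rightarrow> 'a \<Rightarrow> bool) \<Rightarrow> 'a \<Rightarrow> 'a \<Rightarrow> bool" where
  "not_below ge x y \<longleftrightarrow> \<not> ge y x"

definition radial :: "('a::metric_space \<Rightarrow> 'a \<Rightarrow> bool) \<Rightarrow> bool" where
  "radial ge \<longleftrightarrow>
     (\<forall>x y z. not_below ge x y \<and> strict ge y z \<longrightarrow> dist x z \<ge> dist x y) \<and>
     (\<forall>x y z. strict ge x y \<and> not_below ge y z \<longrightarrow> dist x z \<ge> dist y z)"

definition Lip1_up :: "('a::metric_space \<Rightarrow> 'a \<Rightarrow> bool) \<Rightarrow> ('a \<Rightarrow> real) set" where
  "Lip1_up ge = {F. 1-lipschitz_on UNIV F \<and> monotone ge (\<ge>) F}"

definition represents :: "('a \<Rightarrow> real) set \<Rightarrow> ('a \<Rightarrow> 'a \<Rightarrow> bool) \<Rightarrow> bool" where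
  "represents \<F> ge \<longleftrightarrow> (\<forall>x y. ge x y \<longleftrightarrow> (\<forall>F\<in>\<F>. F x \<ge> F y))"

text \<open>
  The value \<open>0\<close> for unbounded \<open>F - G\<close> is a dummy: it keeps \<open>sup_dist\<close> nonnegative on all
  functions, as the library's \<open>Metric_space\<close> requires. On a compact space \<open>F - G\<close> is bounded
  for all Lipschitz \<open>F\<close> and \<open>G\<close>, and \<open>sup_dist\<close> is the uniform metric
  (lemmas \<open>sup_dist_Lip1_up\<close>, \<open>Metric_space_Lip1_up\<close>).
\<close>

definition sup_dist :: "('a \<Rightarrow> real) \<Rightarrow> ('a \<Rightarrow> real) \<Rightarrow> real" where
  "sup_dist F G =
     (if bdd_above (range (\<lambda>x. \<bar>F x - G x\<bar>)) then SUP x. \<bar>F x - G x\<bar> else 0)"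

definition sup_norm :: "('a \<Rightarrow> real) \<Rightarrow> ereal" where
  "sup_norm F = (SUP x. ereal \<bar>F x\<bar>)"

definition compact_in_Lip1_up ::
    "('a::metric_space \<Rightarrow> 'a \<Rightarrow> bool) \<Rightarrow> ('a \<Rightarrow> real) set \<Rightarrow> bool" where
  "compact_in_Lip1_up ge \<F> \<longleftrightarrow>
     compactin (Metric_space.mtopology (Lip1_up ge) sup_dist) \<F>"

lemma bdd_above_Lip1_up_diff:
  fixes ge :: "'a::metric_space \<Rightarrow> 'a \<Rightarrow> bool"
  assumes "compact (UNIV :: 'a set)" "F \<in> Lip1_up ge" "G \<in> Lip1_up ge"
  shows "bdd_above (range (\<lambda>x. \<bar>F x - G x\<bar>))"
proof -
  have "continuous_on UNIV F" "continuous_on UNIV G"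
    using assms(2,3) unfolding Lip1_up_def by (auto intro: lipschitz_on_continuous_on)
  then have "continuous_on UNIV (\<lambda>x. \<bar>F x - G x\<bar>)"
    by (intro continuous_intros)
  then show ?thesis
    using assms(1) by (intro bounded_imp_bdd_above compact_imp_bounded compact_continuous_image)
qed

lemma sup_dist_Lip1_up:
  fixes ge :: "'a::metric_space \<Rightarrow> 'a \<Rightarrow> bool"
  assumes "compact (UNIV :: 'a set)" "F \<in> Lip1_up ge" "G \<in> Lip1_up ge"
  shows "sup_dist F G = (SUP x. \<bar>F x - G x\<bar>)"
  using bdd_above_Lip1_up_diff[OF assms] by (simp add: sup_dist_def)

lemma Metric_space_Lip1_up:
  fixes ge :: "'a::metric_space \<Rightarrow> 'a \<Rightarrow> bool"
  assumes "compact (UNIV :: 'a set)"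
  shows "Metric_space (Lip1_up ge) sup_dist"
proof
  have le: "\<bar>F x - G x\<bar> \<le> sup_dist F G"
    if "F \<in> Lip1_up ge" "G \<in> Lip1_up ge" for F G :: "'a \<Rightarrow> real" and x
    unfolding sup_dist_Lip1_up[OF assms that]
    by (rule cSUP_upper[OF UNIV_I bdd_above_Lip1_up_diff[OF assms that]])
  show "sup_dist F G = sup_dist G F" for F G :: "'a \<Rightarrow> real"
    by (simp add: sup_dist_def abs_minus_commute)
  show "0 \<le> sup_dist F G" for F G :: "'a \<Rightarrow> real"
    by (auto simp: sup_dist_def intro: cSUP_upper2[OF _ UNIV_I])
  show "sup_dist F G = 0 \<longleftrightarrow> F = G" if "F \<in> Lip1_up ge" "G \<in> Lip1_up ge" for F G
  proof
    assume "sup_dist F G = 0"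
    then show "F = G" using le[OF that] by (intro ext) simp
  qed (simp add: sup_dist_def)
  show "sup_dist F H \<le> sup_dist F G + sup_dist G H"
    if "F \<in> Lip1_up ge" "G \<in> Lip1_up ge" "H \<in> Lip1_up ge" for F G H
    unfolding sup_dist_Lip1_up[OF assms that(1,3)]
  proof (rule cSUP_least)
    show "\<bar>F x - H x\<bar> \<le> sup_dist F G + sup_dist G H" for x
      using le[OF that(1,2), of x] le[OF that(2,3), of x] by linarith
  qed simp
qed

end

theory Submission
  imports Defs
begin

text \<open>
  Order and metric interact through distances to lower sets. Radiality says that moving up from a
  point outside a lower set \<open>L\<close> does not bring it closer to any point of \<open>L\<close>, so
  the distance to \<open>L\<close> is increasing, and it is always \<open>1\<close>-Lipschitz
  (\<open>infdist_lower_set_in_Lip1_up\<close>). Radiality also says that the point of the principal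
  lower set \<open>{w. ge x w}\<close> nearest to any \<open>y\<close> outside it is \<open>x\<close> itself
  (\<open>infdist_principal_lower_set\<close>); so the distance to this set vanishes at \<open>x\<close>
  but not at \<open>y\<close>, and refutes \<open>ge x y\<close>. Hence the distances to principal lower
  sets represent the order.

  On a compact space this same family is compact. By radiality once more, the principal lower sets
  of \<open>x\<close> and \<open>x'\<close> are at Hausdorff distance at most \<open>dist x x'\<close>
  (\<open>principal_lower_set_near\<close>), so sending \<open>x\<close> to the distance to its principal
  lower set is a \<open>1\<close>-Lipschitz map into the uniform metric, and the family is its image.
  The bound by the diameter holds because \<open>x\<close> belongs to its own lower set.
\<close>

lemma monotone_Lip1_up: "F \<in> Lip1_up ge \<Longrightarrow> ge x y \<Longrightarrow> F y \<le> F x"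
  using monotoneD[of ge "(\<ge>)" F x y] by (simp add: Lip1_up_def)

lemma infdist_greatest:
  assumes "A \<noteq> {}" "\<And>a. a \<in> A \<Longrightarrow> c \<le> dist x a"
  shows "c \<le> infdist x A"
  unfolding infdist_notempty[OF assms(1)] using assms by (rule cINF_greatest)

text \<open>
  If \<open>z\<close> lies above \<open>z'\<close> and \<open>z'\<close> is outside the lower set \<open>L\<close>,
  then no \<open>l \<in> L\<close> is above \<open>z'\<close>, and the second half of radiality, applied to
  \<open>z\<close>, \<open>z'\<close>, \<open>l\<close>, compares the distances to each \<open>l\<close>
  separately.
\<close>

lemma infdist_lower_set_in_Lip1_up:
  assumes "radial ge" and lower: "\<And>x y. x \<in> L \<Longrightarrow> ge x y \<Longrightarrow> y \<in> L"
  shows "(\<lambda>z. infdist z L) \<in> Lip1_up ge"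
proof -
  have "infdist z' L \<le> infdist z L" if "ge z z'" for z z'
  proof (cases "z' \<in> L \<or> z = z' \<or> L = {}")
    case False
    have "dist z' l \<le> dist z l" if "l \<in> L" for l
    proof -
      have "not_below ge z' l"
        using False lower that by (auto simp: not_below_def)
      then show ?thesis
        using assms(1) \<open>ge z z'\<close> False by (auto simp: radial_def strict_def)
    qed
    then have "infdist z' L \<le> dist z l" if "l \<in> L" for l
      using that by (meson infdist_le2)
    then show ?thesis
      using False by (intro infdist_greatest) auto
  qed (auto simp: infdist_nonneg infdist_def[of _ "{}"])
  moreover have "1-lipschitz_on UNIV (\<lambda>z. infdist z L)"
    by (rule lipschitz_onI) (auto simp: dist_real_def infdist_triangle_abs)
  ultimately show ?thesis
    by (auto simp: Lip1_up_def intro!: monotoneI)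
qed

text \<open>
  This is the first half of radiality, applied to \<open>y\<close>, \<open>x\<close> and a point strictly
  below \<open>x\<close>.
\<close>

lemma infdist_principal_lower_set:
  assumes "radial ge" "reflp ge" "\<not> ge x y"
  shows "infdist y {w. ge x w} = dist y x"
proof (rule antisym)
  have x: "x \<in> {w. ge x w}"
    using assms(2) by (simp add: reflpD)
  then show "infdist y {w. ge x w} \<le> dist y x"
    by (rule infdist_le)
  have "dist y x \<le> dist y w" if "ge x w" for w
    using assms(1,3) that unfolding radial_def strict_def not_below_def by (cases "x = w") auto
  then show "dist y x \<le> infdist y {w. ge x w}"
    using x by (intro infdist_greatest) auto
qed

lemma represents_principal_lower_sets:
  assumes "is_partial_order ge" "radial ge"
  shows "range (\<lambda>x z. infdist z {w. ge x w}) \<subseteq> Lip1_up ge"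
    and "represents (range (\<lambda>x z. infdist z {w. ge x w})) ge"
proof -
  have refl: "reflp ge" and trans: "transp ge"
    using assms(1) by (auto simp: is_partial_order_def)
  show Lip: "range (\<lambda>x z. infdist z {w. ge x w}) \<subseteq> Lip1_up ge"
  proof clarify
    fix x
    show "(\<lambda>z. infdist z {w. ge x w}) \<in> Lip1_up ge"
      by (rule infdist_lower_set_in_Lip1_up[OF assms(2)]) (simp, rule transpD[OF trans])
  qed
  have "ge x y" if ge: "infdist y {w. ge x w} \<le> infdist x {w. ge x w}" for x y
  proof (rule ccontr)
    assume "\<not> ge x y"
    moreover have "infdist x {w. ge x w} = 0"
      using refl by (simp add: reflpD)
    moreover have "x \<noteq> y"
      using \<open>\<not> ge x y\<close> reflpD[OF refl] by blast
    ultimately show False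
      using ge infdist_principal_lower_set[OF assms(2) refl, of x y] by simp
  qed
  moreover have "infdist y {w. ge z w} \<le> infdist x {w. ge z w}" if "ge x y" for x y z
    by (rule monotone_Lip1_up[OF subsetD[OF Lip] that]) simp
  ultimately show "represents (range (\<lambda>x z. infdist z {w. ge x w})) ge"
    unfolding represents_def ball_simps by (metis UNIV_I)
qed

text \<open>
  A point \<open>w\<close> below \<open>x'\<close> but not below \<open>x\<close> is itself close to \<open>x\<close>,
  by the second half of radiality applied to \<open>x'\<close>, \<open>w\<close>, \<open>x\<close>.
\<close>

lemma principal_lower_set_near:
  assumes "radial ge" "reflp ge" "ge x' w"
  obtains v where "ge x v" "dist w v \<le> dist x x'"
proof (cases "ge x w")
  case True
  then show ?thesis
    using that[of w] by simp
next
  case False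
  have "dist w x \<le> dist x x'"
  proof (cases "w = x'")
    case False
    then have "strict ge x' w" "not_below ge w x"
      using assms(3) \<open>\<not> ge x w\<close> by (simp_all add: strict_def not_below_def)
    then show ?thesis
      using assms(1) unfolding radial_def by (metis dist_commute)
  qed (simp add: dist_commute)
  then show ?thesis
    using that[of x] assms(2) by (simp add: reflpD)
qed

lemma infdist_principal_lower_set_Lipschitz:
  assumes "radial ge" "reflp ge"
  shows "\<bar>infdist z {w. ge x w} - infdist z {w. ge x' w}\<bar> \<le> dist x x'"
proof -
  have "infdist z {w. ge x w} \<le> infdist z {w. ge x' w} + dist x x'" for x x'
  proof -
    have "infdist z {w. ge x w} - dist x x' \<le> infdist z {w. ge x' w}"
    proof (rule infdist_greatest)
      show "{w. ge x' w} \<noteq> {}"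
        using reflpD[OF assms(2)] by blast
      fix w assume "w \<in> {w. ge x' w}"
      then obtain v where v: "ge x v" "dist w v \<le> dist x x'"
        using principal_lower_set_near[OF assms] by blast
      have "infdist z {w. ge x w} \<le> dist z v"
        using v(1) by (intro infdist_le) simp
      then show "infdist z {w. ge x w} - dist x x' \<le> dist z w"
        using v(2) dist_triangle[of z v w] by linarith
    qed
    then show ?thesis by linarith
  qed
  from this[of x x'] this[of x' x] show ?thesis
    by (simp add: dist_commute)
qed

lemma compact_in_Lip1_up_principal_lower_sets:
  fixes ge :: "'a::metric_space \<Rightarrow> 'a \<Rightarrow> bool"
  assumes cpt: "compact (UNIV :: 'a set)" and "is_partial_order ge" "radial ge"
  shows "compact_in_Lip1_up ge (range (\<lambda>x z. infdist z {w. ge x w}))"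
proof -
  define \<delta> where "\<delta> = (\<lambda>x z. infdist z {w. ge x w})"
  have Lip: "\<delta> x \<in> Lip1_up ge" for x
    using represents_principal_lower_sets(1)[OF assms(2,3)] by (auto simp: \<delta>_def)
  have le: "sup_dist (\<delta> x) (\<delta> x') \<le> dist x x'" for x x'
    unfolding sup_dist_Lip1_up[OF cpt Lip Lip]
    using infdist_principal_lower_set_Lipschitz[OF assms(3)] assms(2)
    by (intro cSUP_least) (auto simp: \<delta>_def is_partial_order_def)
  interpret M: Metric_space "Lip1_up ge" sup_dist
    by (rule Metric_space_Lip1_up[OF cpt])
  have "continuous_map euclidean M.mtopology \<delta>"
    unfolding M.continuous_map_to_metric
  proof (intro ballI allI impI)
    fix x and e :: real
    assume "0 < e"
    then show "\<exists>U. openin euclidean U \<and> x \<in> U \<and> (\<forall>y\<in>U. \<delta> y \<in> M.mball (\<delta> x) e)"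
      using Lip le_less_trans[OF le] by (intro exI[of _ "ball x e"]) auto
  qed
  then have "compactin M.mtopology (\<delta> ` UNIV)"
    using cpt by (intro image_compactin[of euclidean]) auto
  then show ?thesis
    by (simp add: compact_in_Lip1_up_def \<delta>_def)
qed

lemma infdist_principal_lower_set_le_diameter:
  fixes ge :: "'a::metric_space \<Rightarrow> 'a \<Rightarrow> bool"
  assumes "bounded (UNIV :: 'a set)" "reflp ge"
  shows "infdist z {w. ge x w} \<le> diameter (UNIV :: 'a set)"
proof -
  have "infdist z {w. ge x w} \<le> dist z x"
    using assms(2) by (intro infdist_le) (simp add: reflpD)
  also have "\<dots> \<le> diameter (UNIV :: 'a set)"
    using assms(1) by (intro diameter_bounded_bound) auto
  finally show ?thesis .
qed

theorem proposition5:
  fixes ge :: "'a::metric_space \<Rightarrow> 'a \<Rightarrow> bool"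
  assumes "is_partial_order ge"
    and "radial ge"
  shows "(\<exists>\<F>. \<F> \<subseteq> Lip1_up ge \<and> represents \<F> ge) \<and>
    (compact (UNIV :: 'a set) \<longrightarrow>
      (\<exists>\<F>. \<F> \<subseteq> Lip1_up ge \<and> represents \<F> ge \<and> compact_in_Lip1_up ge \<F> \<and>
          (SUP F\<in>\<F>. sup_norm F) \<le> ereal (diameter (UNIV :: 'a set))))"
proof (intro conjI impI)
  let ?\<F> = "range (\<lambda>x z. infdist z {w. ge x w})"
  note \<F> = represents_principal_lower_sets[OF assms]
  then show "\<exists>\<F>. \<F> \<subseteq> Lip1_up ge \<and> represents \<F> ge"
    by blast

  assume cpt: "compact (UNIV :: 'a set)"
  have "infdist z {w. ge x w} \<le> diameter (UNIV :: 'a set)" for x z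
    using assms(1) compact_imp_bounded[OF cpt]
    by (intro infdist_principal_lower_set_le_diameter) (auto simp: is_partial_order_def)
  then have "(SUP F\<in>?\<F>. sup_norm F) \<le> ereal (diameter (UNIV :: 'a set))"
    by (auto simp: sup_norm_def infdist_nonneg intro!: SUP_least)
  then show "\<exists>\<F>. \<F> \<subseteq> Lip1_up ge \<and> represents \<F> ge \<and> compact_in_Lip1_up ge \<F> \<and>
      (SUP F\<in>\<F>. sup_norm F) \<le> ereal (diameter (UNIV :: 'a set))"
    using \<F> compact_in_Lip1_up_principal_lower_sets[OF cpt assms]
    by (intro exI[of _ ?\<F>] conjI)
qed

end
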